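(* Let $R$ be a unital ring with involution $*$, let $a\in R$ and let $m,n$ be positive integers. Then the following conditions are equivalent: (1) $a\in R^{\dagger}$; (2) $a\in R(a^{*}a)^{m}\cap (aa^{*})^{n}R$; (3) $a\in a(a^{*}a)^{n}R$; (4) $a\in R(aa^{*})^{n}a$; (5) $(aa^{*})^{n}\in R^{\dagger}$ and $(aa^{*})^{n}[(aa^{*})^{n}]^{\dagger}a=a$; (6) $(a^{*}a)^{n}\in R^{\dagger}$ and $a[(a^{*}a)^{n}]^{\dagger}(a^{*}a)^{n}=a$; (7) $a$ is $*$-cancellable and $(aa^{*})^{m}$ and $(a^{*}a)^{n}$ are regular; (8) $a$ is $*$-cancellable and $(a^{*}a)^{n}a^{*}$ is regular; (9) $a$ is $*$-cancellable and $a^{*}(aa^{*})^{n}$ is regular; (10) $a$ is $*$-cancellable and $(aa^{*})^{n}\in R^{\#}$; (11) $a$ is $*$-cancellable and $(a^{*}a)^{n}\in R^{\#}$; (12) $a$ is $*$-cancellable and $(aa^{*})^{n}\in R^{\dagger}$; (13) $a$ is $*$-cancellable and $(a^{*}a)^{n}\in R^{\dagger}$. In this case, $$a^{\dagger}=y_{1}^{*}(aa^{*})^{m+n-2}ax_{1}^{*}=x_{2}^{*}(a^{*}a)^{2n-1}x_{2}a^{*}=a^{*}y_{2}(aa^{*})^{2n-1}y_{2}^{*},$$ where $x_1,y_1,x_2,y_2\in R$ are any elements with $a=x_{1}(a^{*}a)^{m}$, $a=(aa^{*})^{n}y_{1}$, $a=a(a^{*}a)^{n}x_{2}$, $a=y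_{2}(aa^{*})^{n}a$.
   Context: $R$ is a unital (associative, not necessarily commutative) ring with an involution $a\mapsto a^*$, i.e. $(a^* )^*=a$, $(ab)^*=b^*a^*$, $(a+b)^*=a^*+b^*$. Convention: $x^0=1$. An element $b$ is the Moore-Penrose inverse of $a$ if $aba=a$, $bab=b$, $(ab)^*=ab$, $(ba)^*=ba$; it is unique if it exists and is denoted $a^{\dagger}$; $R^{\dagger}$ is the set of Moore-Penrose invertible elements. An element $b$ is the group inverse of $a$ if $aba=a$, $bab=b$, $ab=ba$; it is unique if it exists; $R^{\#}$ is the set of group invertible elements. An element $a$ is regular if there is $b\in R$ with $aba=a$. An element $a\in R$ is $*$-cancellable if for all $x\in R$, $a^{*}ax=0$ implies $ax=0$, and for all $y\in R$, $yaa^{*}=0$ implies $ya=0$. For $c\in R$: $cR=\{cx\mid x\in R\}$, $Rc=\{xc\mid x\in R\}$. *)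

theory Defs
  imports Main
begin

(* The base is "ring + monoid_mult" rather than "ring_1", because "ring_1" includes the axiom
   0 \<noteq> 1; a unital ring is allowed to be the zero ring here. *)
class involution_ring = ring + monoid_mult +
  fixes star :: "'a \<Rightarrow> 'a"  ("_\<^sup>\<star>" [1000] 1000)
  assumes star_star: "(a\<^sup>\<star>)\<^sup>\<star> = a"
    and star_mult: "(a * b)\<^sup>\<star> = b\<^sup>\<star> * a\<^sup>\<star>"
    and star_add: "(a + b)\<^sup>\<star> = a\<^sup>\<star> + b\<^sup>\<star>"

definition is_mp_inverse :: "'a::involution_ring \<Rightarrow> 'a \<Rightarrow> bool" where
  "is_mp_inverse a b \<longleftrightarrow>
     a * b * a = a \<and> b * a * b = b \<and> (a * b)\<^sup>\<star> = a * b \<and> (b * a)\<^sup>\<star> = b * a"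

definition mp_invertible :: "'a::involution_ring \<Rightarrow> bool" where
  "mp_invertible a \<longleftrightarrow> (\<exists>b. is_mp_inverse a b)"

(* Meaningful only if "mp_invertible a"; otherwise an unspecified element. *)
definition mp_inverse :: "'a::involution_ring \<Rightarrow> 'a"  ("_\<^sup>\<dagger>" [1000] 1000) where
  "a\<^sup>\<dagger> = (THE b. is_mp_inverse a b)"

definition group_invertible :: "'a::involution_ring \<Rightarrow> bool" where
  "group_invertible a \<longleftrightarrow> (\<exists>b. a * b * a = a \<and> b * a * b = b \<and> a * b = b * a)"

definition regular_elt :: "'a::involution_ring \<Rightarrow> bool" where
  "regular_elt a \<longleftrightarrow> (\<exists>b. a * b * a = a)"

definition star_cancellable :: "'a::involution_ring \<Rightarrow> bool" where
  "star_cancellable a \<longleftrightarrow>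
     (\<forall>x. a\<^sup>\<star> * a * x = 0 \<longrightarrow> a * x = 0) \<and> (\<forall>y. y * a * a\<^sup>\<star> = 0 \<longrightarrow> y * a = 0)"

(* cR and Rc *)
definition right_multiples :: "'a::involution_ring \<Rightarrow> 'a set" where
  "right_multiples c = {c * x | x. True}"

definition left_multiples :: "'a::involution_ring \<Rightarrow> 'a set" where
  "left_multiples c = {x * c | x. True}"

lemma is_mp_inverse_unique:
  assumes "is_mp_inverse a b" and "is_mp_inverse a c"
  shows "b = c"
proof -
  have b: "a * b * a = a" "b * a * b = b" "(a * b)\<^sup>\<star> = a * b" "(b * a)\<^sup>\<star> = b * a"
    and c: "a * c * a = a" "c * a * c = c" "(a * c)\<^sup>\<star> = a * c" "(c * a)\<^sup>\<star> = c * a"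
    using assms by (auto simp: is_mp_inverse_def)
  have "a * b = (a * c) * (a * b)"
    using c(1) by (metis mult.assoc)
  also have "\<dots> = ((a * b) * (a * c))\<^sup>\<star>"
    by (simp only: star_mult[of "a * b" "a * c"] b(3) c(3))
  also have "\<dots> = a * c"
    using b(1) c(3) by (metis mult.assoc)
  finally have ab: "a * b = a * c" .
  have "b * a = (b * a) * (c * a)"
    using c(1) by (metis mult.assoc)
  also have "\<dots> = ((c * a) * (b * a))\<^sup>\<star>"
    by (simp only: star_mult[of "c * a" "b * a"] b(4) c(4))
  also have "\<dots> = c * a"
    using b(1) c(4) by (metis mult.assoc)
  finally have ba: "b * a = c * a" .
  show ?thesis
    using ab ba b(2) c(2) by (metis mult.assoc)
qed

lemma mp_inverse_eqI: "is_mp_inverse a b \<Longrightarrow> a\<^sup>\<dagger> = b"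
  unfolding mp_inverse_def using is_mp_inverse_unique by blast

lemma is_mp_inverse_mp_inverse: "mp_invertible a \<Longrightarrow> is_mp_inverse a (a\<^sup>\<dagger>)"
  unfolding mp_invertible_def using mp_inverse_eqI by blast

end

theory Submission
  imports Defs
begin

text \<open>
  Write \<open>u = a\<^sup>\<star> * a\<close> and \<open>h = a * a\<^sup>\<star>\<close>. The Moore-Penrose inverse is governed by two projections,
  \<open>e = a * a\<^sup>\<dagger>\<close> and \<open>f = a\<^sup>\<dagger> * a\<close>, and everything rests on the fact that they can be read off from
  solutions of one-sided equations: if \<open>a = x * u\<close> and \<open>a = h * y\<close>, then \<open>a * x\<^sup>\<star> = x * u * x\<^sup>\<star>\<close> and
  \<open>y\<^sup>\<star> * a = y\<^sup>\<star> * h * y\<close> are visibly self-adjoint, they are \<open>e\<close> and \<open>f\<close>, and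
  \<open>a\<^sup>\<dagger> = y\<^sup>\<star> * a * x\<^sup>\<star>\<close> (\<open>is_mp_inverse_of_factorizations\<close>). The single equation \<open>a = a * u * x\<close> already
  supplies both factorizations, because it forces \<open>u * x\<close> to be self-adjoint. Since
  \<open>a * u ^ n = h ^ n * a\<close>, surplus powers of \<open>u\<close> and \<open>h\<close> can be absorbed into \<open>x\<close> and \<open>y\<close>; this gives the
  sufficiency of the ideal conditions for every positive exponent together with all formulas for \<open>a\<^sup>\<dagger>\<close>.

  Conversely, if \<open>a\<^sup>\<dagger>\<close> exists, then \<open>u\<close> commutes with its Moore-Penrose inverse
  \<open>a\<^sup>\<dagger> * (a\<^sup>\<dagger>)\<^sup>\<star>\<close>, so the powers of the latter are at once group inverses and Moore-Penrose inverses of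
  the powers of \<open>u\<close>, and \<open>u ^ n\<close> times its inverse is \<open>f\<close> for each positive \<open>n\<close>. The necessity
  claims come from this and from \<open>e * a = a = a * f\<close>.

  In the remaining conditions, \<open>\<star>\<close>-cancellability turns an equation between right multiples of \<open>u ^ n\<close> into
  the same equation with \<open>u ^ n\<close> replaced by \<open>a\<close>: one factor \<open>a\<close> or \<open>a\<^sup>\<star>\<close> is cancelled at a time
  (\<open>cancel_gram_power\<close>). A regularity or invertibility hypothesis thereby becomes a
  factorization of \<open>a\<close>.

  Passing from \<open>a\<close> to \<open>a\<^sup>\<star>\<close> exchanges \<open>u\<close> with \<open>h\<close> and, after taking adjoints, left with right. It
  preserves Moore-Penrose invertibility and \<open>\<star>\<close>-cancellability, so one-sided arguments are carried out
  for \<open>u\<close> and transported to \<open>h\<close> by the involution.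
\<close>

section \<open>The involution and powers\<close>

lemma star_one [simp]: "(1::'a::involution_ring)\<^sup>\<star> = 1"
  by (metis mult_1_left mult_1_right star_mult star_star)

lemma star_zero [simp]: "(0::'a::involution_ring)\<^sup>\<star> = 0"
  by (metis add_cancel_right_right star_add)

lemma star_eq_iff: "(x::'a::involution_ring)\<^sup>\<star> = y\<^sup>\<star> \<longleftrightarrow> x = y"
  by (metis star_star)

lemma star_power: "((x::'a::involution_ring) ^ n)\<^sup>\<star> = (x\<^sup>\<star>) ^ n"
  by (induction n) (simp_all add: star_mult power_commutes)

lemma star_gram_power [simp]:
  fixes a :: "'a::involution_ring"
  shows "((a\<^sup>\<star> * a) ^ n)\<^sup>\<star> = (a\<^sup>\<star> * a) ^ n" and "((a * a\<^sup>\<star>) ^ n)\<^sup>\<star> = (a * a\<^sup>\<star>) ^ n"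
  by (simp_all add: star_power star_mult star_star)

lemma mult_power_shift:
  fixes a b :: "'a::monoid_mult"
  shows "a * (b * a) ^ n = (a * b) ^ n * a"
  by (induction n) (simp_all add: mult.assoc power_commutes)

lemma power_mult_power_idempotent:
  fixes h k :: "'a::monoid_mult"
  assumes comm: "h * k = k * h" and idem: "h * k * (h * k) = h * k" and "n > 0"
  shows "h ^ n * k ^ n = h * k" and "k ^ n * h ^ n = h * k"
proof -
  have pow: "(h * k) ^ Suc j = h * k" for j
    by (induction j) (simp_all add: idem)
  have hk: "h ^ i * k = k * h ^ i" for i
    using comm by (metis power_commuting_commutes)
  have "h ^ i * k ^ i = (h * k) ^ i" for i
  proof (induction i)
    case (Suc i)
    have "h ^ Suc i * k ^ Suc i = h * (h ^ i * k) * k ^ i"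
      by (simp add: mult.assoc)
    then show ?case
      by (simp add: hk mult.assoc flip: Suc.IH)
  qed simp
  moreover have "k ^ i * h ^ i = h ^ i * k ^ i" for i
    using hk by (metis power_commuting_commutes)
  ultimately have "h ^ n * k ^ n = (h * k) ^ n" "k ^ n * h ^ n = (h * k) ^ n"
    by simp_all
  then show "h ^ n * k ^ n = h * k" "k ^ n * h ^ n = h * k"
    using pow[of "n - 1"] \<open>n > 0\<close> by simp_all
qed

section \<open>Moore-Penrose inverses from factorizations\<close>

lemma is_mp_inverse_star:
  "is_mp_inverse (a\<^sup>\<star>) (b\<^sup>\<star>) \<longleftrightarrow> is_mp_inverse (a::'a::involution_ring) b"
proof -
  have "is_mp_inverse (c\<^sup>\<star>) (d\<^sup>\<star>)" if "is_mp_inverse c d" for c d :: 'a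
    using that unfolding is_mp_inverse_def
    by (metis mult.assoc star_mult)
  from this[of a b] this[of "a\<^sup>\<star>" "b\<^sup>\<star>"] show ?thesis
    by (auto simp: star_star)
qed

lemma mp_invertible_star: "mp_invertible (a\<^sup>\<star>) \<longleftrightarrow> mp_invertible (a::'a::involution_ring)"
  unfolding mp_invertible_def using is_mp_inverse_star star_star by metis

text \<open>
  The products \<open>a * x\<^sup>\<star> = x * (a\<^sup>\<star> * a) * x\<^sup>\<star>\<close> and \<open>y\<^sup>\<star> * a = y\<^sup>\<star> * (a * a\<^sup>\<star>) * y\<close> are self-adjoint
  by inspection, and this symmetry is what lets them act as identities on \<open>a\<close> from the left and
  from the right.
\<close>
lemma is_mp_inverse_of_factorizations:
  fixes a x y :: "'a::involution_ring"
  assumes x: "a = x * (a\<^sup>\<star> * a)" and y: "a = (a * a\<^sup>\<star>) * y"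
  shows "is_mp_inverse a (y\<^sup>\<star> * a * x\<^sup>\<star>)"
proof -
  define e f where "e = a * x\<^sup>\<star>" and "f = y\<^sup>\<star> * a"
  have "e = x * (a\<^sup>\<star> * a) * x\<^sup>\<star>"
    using x by (simp add: e_def)
  then have e_star: "e\<^sup>\<star> = e"
    by (simp add: star_mult star_star mult.assoc)
  have "f = y\<^sup>\<star> * ((a * a\<^sup>\<star>) * y)"
    using y by (simp add: f_def)
  then have f_star: "f\<^sup>\<star> = f"
    by (simp add: star_mult star_star mult.assoc)
  have ea: "e * a = a"
  proof -
    have "e * a = e\<^sup>\<star> * a" by (simp add: e_star)
    also have "\<dots> = a" using x by (simp add: e_def star_mult star_star mult.assoc)
    finally show ?thesis .
  qed
  have af: "a * f = a"
  proof -
    have "a * f = a * f\<^sup>\<star>" by (simp add: f_star)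
    also have "\<dots> = a" using y by (simp add: f_def star_mult star_star mult.assoc)
    finally show ?thesis .
  qed
  define b where "b = y\<^sup>\<star> * a * x\<^sup>\<star>"
  have ab: "a * b = e"
  proof -
    have "a * b = a * f * x\<^sup>\<star>" by (simp add: b_def f_def mult.assoc)
    then show ?thesis by (simp add: af e_def)
  qed
  have ba: "b * a = f"
  proof -
    have "b * a = y\<^sup>\<star> * (e * a)" by (simp add: b_def e_def mult.assoc)
    then show ?thesis by (simp add: ea f_def)
  qed
  have "b * a * b = b"
  proof -
    have "f * f = f" using af by (simp add: f_def mult.assoc)
    moreover have "b = f * x\<^sup>\<star>" by (simp add: b_def f_def)
    ultimately show ?thesis by (metis ba mult.assoc)
  qed
  then have "is_mp_inverse a b"
    unfolding is_mp_inverse_def by (simp add: ab ba ea e_star f_star)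
  then show ?thesis by (simp add: b_def)
qed

lemma is_mp_inverse_of_power_factorizations:
  fixes a x y :: "'a::involution_ring"
  assumes "m > 0" and "n > 0"
    and x: "a = x * (a\<^sup>\<star> * a) ^ m" and y: "a = (a * a\<^sup>\<star>) ^ n * y"
  shows "is_mp_inverse a (y\<^sup>\<star> * (a * a\<^sup>\<star>) ^ (m + n - 2) * a * x\<^sup>\<star>)"
proof -
  obtain i j where mn: "m = Suc i" "n = Suc j"
    using assms(1,2) gr0_implies_Suc by blast
  have "a = x * (a\<^sup>\<star> * a) ^ i * (a\<^sup>\<star> * a)"
    using x by (simp add: mn mult.assoc power_commutes)
  moreover have "a = (a * a\<^sup>\<star>) * ((a * a\<^sup>\<star>) ^ j * y)"
    using y by (simp add: mn mult.assoc)
  ultimately have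
    "is_mp_inverse a (((a * a\<^sup>\<star>) ^ j * y)\<^sup>\<star> * a * (x * (a\<^sup>\<star> * a) ^ i)\<^sup>\<star>)"
    by (rule is_mp_inverse_of_factorizations)
  also have "((a * a\<^sup>\<star>) ^ j * y)\<^sup>\<star> * a * (x * (a\<^sup>\<star> * a) ^ i)\<^sup>\<star>
      = y\<^sup>\<star> * (a * a\<^sup>\<star>) ^ j * (a * (a\<^sup>\<star> * a) ^ i) * x\<^sup>\<star>"
    by (simp add: star_mult mult.assoc)
  also have "\<dots> = y\<^sup>\<star> * (a * a\<^sup>\<star>) ^ (m + n - 2) * a * x\<^sup>\<star>"
    by (simp add: mn mult_power_shift mult.assoc add.commute[of i j] power_add)
  finally show ?thesis .
qed

text \<open>
  With \<open>u = a\<^sup>\<star> * a\<close>, the hypothesis gives \<open>u = x\<^sup>\<star> * u * u\<close>, hence \<open>u * x = (x\<^sup>\<star> * u) * (u * x)\<close>, which is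
  of the form \<open>p\<^sup>\<star> * p\<close> and therefore self-adjoint. So \<open>u * x = x\<^sup>\<star> * u\<close>, and the right factorization
  \<open>a = a * u * x\<close> is also the left factorization \<open>a = a * x\<^sup>\<star> * u\<close>.
\<close>
lemma is_mp_inverse_of_right_factorization:
  fixes a x :: "'a::involution_ring"
  assumes x: "a = a * (a\<^sup>\<star> * a) * x"
  shows "is_mp_inverse a (x\<^sup>\<star> * (a\<^sup>\<star> * a) * x * a\<^sup>\<star>)"
proof -
  define u where "u = a\<^sup>\<star> * a"
  have u_star: "u\<^sup>\<star> = u" by (simp add: u_def star_mult star_star)
  have "u = u * u * x"
    using x by (metis u_def mult.assoc)
  then have uux: "u = x\<^sup>\<star> * u * u"
    by (metis mult.assoc star_mult u_star)
  have ux: "u * x = (x\<^sup>\<star> * u) * (u * x)"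
    using uux by (metis mult.assoc)
  have "(u * x)\<^sup>\<star> = u * x"
    by (subst (1 2) ux) (simp add: star_mult star_star u_star mult.assoc)
  then have sym: "u * x = x\<^sup>\<star> * u"
    by (simp add: star_mult u_star)
  have "a = a * x\<^sup>\<star> * (a\<^sup>\<star> * a)"
    using x sym by (metis u_def mult.assoc)
  moreover have "a = (a * a\<^sup>\<star>) * (a * x)"
    using x by (simp add: mult.assoc)
  ultimately have "is_mp_inverse a ((a * x)\<^sup>\<star> * a * (a * x\<^sup>\<star>)\<^sup>\<star>)"
    by (rule is_mp_inverse_of_factorizations)
  then show ?thesis
    by (simp add: star_mult star_star mult.assoc)
qed

lemma is_mp_inverse_of_right_power_factorization:
  fixes a x :: "'a::involution_ring"
  assumes "n > 0" and x: "a = a * (a\<^sup>\<star> * a) ^ n * x"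
  shows "is_mp_inverse a (x\<^sup>\<star> * (a\<^sup>\<star> * a) ^ (2 * n - 1) * x * a\<^sup>\<star>)"
proof -
  obtain j where n: "n = Suc j"
    using \<open>n > 0\<close> gr0_implies_Suc by blast
  define u where "u = a\<^sup>\<star> * a"
  have "a = a * u * (u ^ j * x)"
    using x by (simp add: n u_def mult.assoc)
  then have "is_mp_inverse a ((u ^ j * x)\<^sup>\<star> * u * (u ^ j * x) * a\<^sup>\<star>)"
    unfolding u_def by (rule is_mp_inverse_of_right_factorization)
  moreover have "(u ^ j * x)\<^sup>\<star> = x\<^sup>\<star> * u ^ j"
    by (simp add: u_def star_mult)
  moreover have "u ^ j * (u * u ^ j) = u ^ (2 * n - 1)"
    by (simp add: n mult_2 power_add power_commutes flip: mult.assoc)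
  ultimately show ?thesis
    by (metis u_def mult.assoc)
qed

lemma is_mp_inverse_of_left_power_factorization:
  fixes a y :: "'a::involution_ring"
  assumes "n > 0" and y: "a = y * (a * a\<^sup>\<star>) ^ n * a"
  shows "is_mp_inverse a (a\<^sup>\<star> * y * (a * a\<^sup>\<star>) ^ (2 * n - 1) * y\<^sup>\<star>)"
proof -
  have "a\<^sup>\<star> = (y * (a * a\<^sup>\<star>) ^ n * a)\<^sup>\<star>"
    using y by simp
  then have "a\<^sup>\<star> = a\<^sup>\<star> * (a\<^sup>\<star>\<^sup>\<star> * a\<^sup>\<star>) ^ n * y\<^sup>\<star>"
    by (simp add: star_mult star_star mult.assoc)
  from is_mp_inverse_of_right_power_factorization[OF \<open>n > 0\<close> this]
  have "is_mp_inverse (a\<^sup>\<star>) ((a\<^sup>\<star> * y * (a * a\<^sup>\<star>) ^ (2 * n - 1) * y\<^sup>\<star>)\<^sup>\<star>)"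
    by (simp add: star_mult star_star mult.assoc)
  then show ?thesis
    by (simp only: is_mp_inverse_star)
qed

section \<open>Consequences of Moore-Penrose invertibility\<close>

text \<open>
  The inverse of \<open>a\<^sup>\<star> * a\<close> is \<open>b * b\<^sup>\<star>\<close>, and the two commute because both products collapse to the
  projection \<open>b * a\<close>. Commutation is what allows passing to powers.
\<close>
lemma is_mp_inverse_gram_power:
  fixes a b :: "'a::involution_ring"
  assumes ab: "is_mp_inverse a b" and "n > 0"
  defines "u \<equiv> (a\<^sup>\<star> * a) ^ n" and "k \<equiv> (b * b\<^sup>\<star>) ^ n"
  shows "u * k = b * a" and "k * u = b * a" and "is_mp_inverse u k"
proof -
  have aba: "a * b * a = a" and bab: "b * a * b = b"
    and e: "(a * b)\<^sup>\<star> = a * b" and f: "(b * a)\<^sup>\<star> = b * a"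
    using ab by (auto simp: is_mp_inverse_def)
  have bs: "b\<^sup>\<star> * a\<^sup>\<star> = a * b" and as: "a\<^sup>\<star> * b\<^sup>\<star> = b * a"
    using e f by (simp_all add: star_mult)
  have "a\<^sup>\<star> * (a * b) = a\<^sup>\<star>"
    using aba e by (metis star_mult)
  then have l: "(a\<^sup>\<star> * a) * (b * b\<^sup>\<star>) = b * a"
    using as by (metis mult.assoc)
  have r: "(b * b\<^sup>\<star>) * (a\<^sup>\<star> * a) = b * a"
    using bs bab by (metis mult.assoc)
  have idem: "(b * a) * (b * a) = b * a"
    using bab by (metis mult.assoc)
  show uk: "u * k = b * a" and ku: "k * u = b * a"
    unfolding u_def k_def
    using power_mult_power_idempotent[of "a\<^sup>\<star> * a" "b * b\<^sup>\<star>", OF _ _ \<open>n > 0\<close>] l r idem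
    by simp_all
  obtain j where n: "n = Suc j"
    using \<open>n > 0\<close> gr0_implies_Suc by blast
  have "(b * a) * a\<^sup>\<star> = a\<^sup>\<star>"
    using aba f by (metis mult.assoc star_mult)
  then have "b * a * u = u"
    by (metis n u_def power_Suc mult.assoc)
  moreover have "b * a * k = k"
    using bab by (metis n k_def power_Suc mult.assoc)
  ultimately show "is_mp_inverse u k"
    unfolding is_mp_inverse_def by (simp add: uk ku f)
qed

text \<open>
  The projection \<open>b * a\<close> fixes \<open>a\<close> from the right and is a multiple of \<open>(a\<^sup>\<star> * a) ^ n\<close> on either side,
  so \<open>a\<close> acquires any power of \<open>a\<^sup>\<star> * a\<close> as a factor.
\<close>
lemma mp_invertible_factorizations:
  fixes a :: "'a::involution_ring"
  assumes "mp_invertible a" and "n > 0"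
  shows "\<exists>x. a = a * (a\<^sup>\<star> * a) ^ n * x" and "\<exists>x. a = a * x * (a\<^sup>\<star> * a) ^ n"
proof -
  obtain b where ab: "is_mp_inverse a b"
    using assms(1) by (auto simp: mp_invertible_def)
  then have "a = a * (b * a)"
    by (simp add: is_mp_inverse_def mult.assoc)
  then show "\<exists>x. a = a * (a\<^sup>\<star> * a) ^ n * x" "\<exists>x. a = a * x * (a\<^sup>\<star> * a) ^ n"
    using is_mp_inverse_gram_power(1,2)[OF ab \<open>n > 0\<close>] by (metis mult.assoc)+
qed

text \<open>
  Cancellation on one side uses \<open>a = b\<^sup>\<star> * (a\<^sup>\<star> * a)\<close>, and on the other \<open>a = (a * a\<^sup>\<star>) * b\<^sup>\<star>\<close>.
\<close>
lemma mp_invertible_imp_star_cancellable: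
  fixes a :: "'a::involution_ring"
  assumes "mp_invertible a"
  shows "star_cancellable a"
proof -
  obtain b where "is_mp_inverse a b"
    using assms by (auto simp: mp_invertible_def)
  then have l: "a = b\<^sup>\<star> * (a\<^sup>\<star> * a)" and r: "a = (a * a\<^sup>\<star>) * b\<^sup>\<star>"
    unfolding is_mp_inverse_def by (metis mult.assoc star_mult)+
  have "a * x = 0" if "a\<^sup>\<star> * a * x = 0" for x
    using that l by (metis mult.assoc mult_zero_right)
  moreover have "y * a = 0" if "y * a * a\<^sup>\<star> = 0" for y
    using that r by (metis mult.assoc mult_zero_left)
  ultimately show ?thesis
    by (simp add: star_cancellable_def)
qed

lemma mp_invertible_gram_power:
  fixes a :: "'a::involution_ring"
  assumes "mp_invertible a" and "n > 0"
  shows "mp_invertible ((a\<^sup>\<star> * a) ^ n)" and "group_invertible ((a\<^sup>\<star> * a) ^ n)"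
    and "a * ((a\<^sup>\<star> * a) ^ n)\<^sup>\<dagger> * (a\<^sup>\<star> * a) ^ n = a"
proof -
  obtain b where ab: "is_mp_inverse a b"
    using assms(1) by (auto simp: mp_invertible_def)
  note k = is_mp_inverse_gram_power[OF ab \<open>n > 0\<close>]
  show "mp_invertible ((a\<^sup>\<star> * a) ^ n)"
    using k(3) by (auto simp: mp_invertible_def)
  show "group_invertible ((a\<^sup>\<star> * a) ^ n)"
    using k unfolding group_invertible_def is_mp_inverse_def by metis
  have "a * (b * a) = a"
    using ab by (simp add: is_mp_inverse_def mult.assoc)
  then show "a * ((a\<^sup>\<star> * a) ^ n)\<^sup>\<dagger> * (a\<^sup>\<star> * a) ^ n = a"
    by (simp add: mp_inverse_eqI[OF k(3)] k(2) mult.assoc)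
qed

lemma mp_inverse_self_adjoint:
  fixes c :: "'a::involution_ring"
  assumes "mp_invertible c" and "c\<^sup>\<star> = c"
  shows "(c\<^sup>\<dagger>)\<^sup>\<star> = c\<^sup>\<dagger>"
  using is_mp_inverse_mp_inverse[OF assms(1)] assms(2) is_mp_inverse_star mp_inverse_eqI by metis

text \<open>
  If \<open>c\<close>, and hence \<open>c\<^sup>\<dagger>\<close>, is self-adjoint, then the projections \<open>c\<^sup>\<dagger> * c\<close> and \<open>c * c\<^sup>\<dagger>\<close> are each other's
  adjoints; being self-adjoint, they coincide. With \<open>c = (a\<^sup>\<star> * a) ^ n\<close> this moves the power from the
  right of its inverse to the left.
\<close>
lemma mp_inverse_commutes_self_adjoint:
  fixes c :: "'a::involution_ring"
  assumes "mp_invertible c" and "c\<^sup>\<star> = c"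
  shows "c\<^sup>\<dagger> * c = c * c\<^sup>\<dagger>"
  using is_mp_inverse_mp_inverse[OF assms(1)] mp_inverse_self_adjoint[OF assms] assms(2)
  unfolding is_mp_inverse_def by (metis star_mult)

text \<open>
  With \<open>b = a\<^sup>\<dagger>\<close> and \<open>k\<close> the inverse of \<open>u = (a\<^sup>\<star> * a) ^ n\<close>, an inner inverse of \<open>u * a\<^sup>\<star>\<close> is \<open>b\<^sup>\<star> * k\<close>: in
  \<open>(u * a\<^sup>\<star>) * (b\<^sup>\<star> * k) * (u * a\<^sup>\<star>)\<close> the inner pairs \<open>a\<^sup>\<star> * b\<^sup>\<star>\<close> and \<open>k * u\<close> are both the projection
  \<open>b * a\<close>.
\<close>
lemma mp_invertible_imp_regular_gram_power_star:
  fixes a :: "'a::involution_ring"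
  assumes "mp_invertible a" and "n > 0"
  shows "regular_elt ((a\<^sup>\<star> * a) ^ n * a\<^sup>\<star>)"
proof -
  obtain b where ab: "is_mp_inverse a b"
    using assms(1) by (auto simp: mp_invertible_def)
  define u k where "u = (a\<^sup>\<star> * a) ^ n" and "k = (b * b\<^sup>\<star>) ^ n"
  have ku: "k * u = b * a" and uku: "u * k * u = u"
    using is_mp_inverse_gram_power[OF ab \<open>n > 0\<close>]
    by (auto simp: u_def k_def is_mp_inverse_def)
  have as: "a\<^sup>\<star> * b\<^sup>\<star> = b * a"
    using ab by (simp add: is_mp_inverse_def star_mult)
  have idem: "b * a * (b * a) = b * a"
    using ab by (metis is_mp_inverse_def mult.assoc)
  have "(u * a\<^sup>\<star>) * (b\<^sup>\<star> * k) * (u * a\<^sup>\<star>) = u * (a\<^sup>\<star> * b\<^sup>\<star>) * (k * u) * a\<^sup>\<star>"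
    by (simp add: mult.assoc)
  also have "\<dots> = u * (b * a * (b * a)) * a\<^sup>\<star>"
    by (simp only: as ku mult.assoc)
  also have "\<dots> = u * a\<^sup>\<star>"
    by (simp only: idem) (metis ku uku mult.assoc)
  finally show ?thesis
    unfolding regular_elt_def u_def by blast
qed

section \<open>Cancellable elements\<close>

lemma star_cancellableD:
  fixes a :: "'a::involution_ring"
  assumes "star_cancellable a"
  shows "a\<^sup>\<star> * a * x = 0 \<Longrightarrow> a * x = 0" and "y * a * a\<^sup>\<star> = 0 \<Longrightarrow> y * a = 0"
  using assms unfolding star_cancellable_def by blast+

lemma star_cancellable_star:
  fixes a :: "'a::involution_ring"
  shows "star_cancellable (a\<^sup>\<star>) \<longleftrightarrow> star_cancellable a"
proof -
  have "star_cancellable (c\<^sup>\<star>)" if c: "star_cancellable c" for c :: 'a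
    unfolding star_cancellable_def
  proof (intro conjI allI impI)
    fix x assume "c\<^sup>\<star>\<^sup>\<star> * c\<^sup>\<star> * x = 0"
    then have "(c * c\<^sup>\<star> * x)\<^sup>\<star> = 0" by (simp add: star_star)
    then have "x\<^sup>\<star> * c * c\<^sup>\<star> = 0" by (simp add: star_mult star_star mult.assoc)
    then have "x\<^sup>\<star> * c = 0" by (rule star_cancellableD(2)[OF c])
    then have "(x\<^sup>\<star> * c)\<^sup>\<star> = 0" by simp
    then show "c\<^sup>\<star> * x = 0" by (simp add: star_mult star_star)
  next
    fix y assume "y * c\<^sup>\<star> * c\<^sup>\<star>\<^sup>\<star> = 0"
    then have "(y * c\<^sup>\<star> * c)\<^sup>\<star> = 0" by (simp add: star_star)
    then have "c\<^sup>\<star> * c * y\<^sup>\<star> = 0" by (simp add: star_mult star_star mult.assoc)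
    then have "c * y\<^sup>\<star> = 0" by (rule star_cancellableD(1)[OF c])
    then have "(c * y\<^sup>\<star>)\<^sup>\<star> = 0" by simp
    then show "y * c\<^sup>\<star> = 0" by (simp add: star_mult star_star)
  qed
  from this[of a] this[of "a\<^sup>\<star>"] show ?thesis
    by (auto simp: star_star)
qed

text \<open>
  By linearity \<open>y = 0\<close> may be assumed. Each positive power of \<open>a\<^sup>\<star> * a\<close> is an alternating word in \<open>a\<^sup>\<star>\<close>
  and \<open>a\<close>. Its leading letter can be removed as long as two letters remain, because \<open>a\<close> and \<open>a\<^sup>\<star>\<close> are
  both cancellable; the last letter left is \<open>a\<close>.
\<close>
lemma cancel_gram_power:
  fixes a x :: "'a::involution_ring"
  assumes canc: "star_cancellable a" and "n > 0"
    and "(a\<^sup>\<star> * a) ^ n * x = (a\<^sup>\<star> * a) ^ n * y"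
  shows "a * x = a * y"
proof -
  have left: "a * z = 0" if "a\<^sup>\<star> * a * z = 0" for z
    using star_cancellableD(1)[OF canc that] .
  have left': "a\<^sup>\<star> * z = 0" if "a * a\<^sup>\<star> * z = 0" for z
    using star_cancellableD(1)[of "a\<^sup>\<star>" z] canc that
    by (simp only: star_cancellable_star star_star)
  have "a * z = 0" if "(a\<^sup>\<star> * a) ^ Suc j * z = 0" for j z
    using that
  proof (induction j)
    case 0
    then show ?case using left by simp
  next
    case (Suc j)
    then have "a\<^sup>\<star> * a * (a\<^sup>\<star> * a * ((a\<^sup>\<star> * a) ^ j * z)) = 0"
      by (simp add: mult.assoc)
    then have "a * (a\<^sup>\<star> * a * ((a\<^sup>\<star> * a) ^ j * z)) = 0"
      by (rule left)
    then have "a\<^sup>\<star> * (a * ((a\<^sup>\<star> * a) ^ j * z)) = 0"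
      by (intro left') (simp add: mult.assoc)
    then show ?case
      by (intro Suc.IH) (simp add: mult.assoc)
  qed
  from this[of "n - 1" "x - y"] show ?thesis
    using assms(2,3) by (simp add: right_diff_distrib)
qed

text \<open>
  In \<open>(a\<^sup>\<star> * a) ^ n * b = (a\<^sup>\<star> * a) ^ n\<close> the power can be traded for \<open>a\<close>; regularity, group invertibility and
  Moore-Penrose invertibility of \<open>(a\<^sup>\<star> * a) ^ n\<close> only differ in the form of the \<open>b\<close> they provide.
\<close>
lemma factorization_of_regular_gram_power:
  fixes a :: "'a::involution_ring"
  assumes "star_cancellable a" and "n > 0" and "regular_elt ((a\<^sup>\<star> * a) ^ n)"
  shows "\<exists>x. a = x * (a\<^sup>\<star> * a) ^ n"
proof -
  obtain c where "(a\<^sup>\<star> * a) ^ n * c * (a\<^sup>\<star> * a) ^ n = (a\<^sup>\<star> * a) ^ n"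
    using assms(3) by (auto simp: regular_elt_def)
  then have "a * (c * (a\<^sup>\<star> * a) ^ n) = a * 1"
    by (intro cancel_gram_power[OF assms(1,2)]) (simp add: mult.assoc)
  then show ?thesis by (metis mult.assoc mult_1_right)
qed

lemma mp_invertible_of_cancellable_gram_power:
  fixes a :: "'a::involution_ring"
  assumes canc: "star_cancellable a" and "n > 0"
    and c: "(a\<^sup>\<star> * a) ^ n = (a\<^sup>\<star> * a) ^ n * ((a\<^sup>\<star> * a) ^ n * c)"
  shows "mp_invertible a"
proof -
  have "a * ((a\<^sup>\<star> * a) ^ n * c) = a * 1"
    using c by (intro cancel_gram_power[OF canc \<open>n > 0\<close>]) simp
  then have "a = a * (a\<^sup>\<star> * a) ^ n * c"
    by (simp add: mult.assoc)
  then show ?thesis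
    using is_mp_inverse_of_right_power_factorization[OF \<open>n > 0\<close>] mp_invertible_def by blast
qed

section \<open>The characterizations\<close>

lemma mp_invertible_iff_right_multiple:
  fixes a :: "'a::involution_ring"
  assumes "n > 0"
  shows "mp_invertible a \<longleftrightarrow> (\<exists>x. a = a * (a\<^sup>\<star> * a) ^ n * x)"
  using mp_invertible_factorizations(1)[OF _ assms]
    is_mp_inverse_of_right_power_factorization[OF assms] mp_invertible_def by metis

lemma mp_invertible_iff_gram_projection:
  fixes a :: "'a::involution_ring"
  assumes "n > 0"
  shows "mp_invertible a \<longleftrightarrow>
    mp_invertible ((a\<^sup>\<star> * a) ^ n) \<and> a * ((a\<^sup>\<star> * a) ^ n)\<^sup>\<dagger> * (a\<^sup>\<star> * a) ^ n = a"
proof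
  assume "mp_invertible a"
  then show "mp_invertible ((a\<^sup>\<star> * a) ^ n) \<and> a * ((a\<^sup>\<star> * a) ^ n)\<^sup>\<dagger> * (a\<^sup>\<star> * a) ^ n = a"
    using mp_invertible_gram_power[OF _ assms] by blast
next
  assume "mp_invertible ((a\<^sup>\<star> * a) ^ n) \<and> a * ((a\<^sup>\<star> * a) ^ n)\<^sup>\<dagger> * (a\<^sup>\<star> * a) ^ n = a"
  then have "a = a * (a\<^sup>\<star> * a) ^ n * ((a\<^sup>\<star> * a) ^ n)\<^sup>\<dagger>"
    using mp_inverse_commutes_self_adjoint[of "(a\<^sup>\<star> * a) ^ n"] by (simp add: mult.assoc)
  then show "mp_invertible a"
    using mp_invertible_iff_right_multiple[OF assms] by blast
qed

text \<open>
  If \<open>c\<close> is an inner inverse of \<open>(a\<^sup>\<star> * a) ^ n * a\<^sup>\<star>\<close>, cancelling the power and then the remaining \<open>a\<close> leaves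
  \<open>a\<^sup>\<star> = a\<^sup>\<star> * c * (a\<^sup>\<star> * a) ^ n * a\<^sup>\<star>\<close>, whose adjoint exhibits \<open>a\<close> as a right multiple of
  \<open>a * (a\<^sup>\<star> * a) ^ n\<close>.
\<close>
lemma mp_invertible_iff_regular_gram_power_star:
  fixes a :: "'a::involution_ring"
  assumes "n > 0"
  shows "mp_invertible a \<longleftrightarrow> star_cancellable a \<and> regular_elt ((a\<^sup>\<star> * a) ^ n * a\<^sup>\<star>)"
proof
  assume "mp_invertible a"
  then show "star_cancellable a \<and> regular_elt ((a\<^sup>\<star> * a) ^ n * a\<^sup>\<star>)"
    using mp_invertible_imp_star_cancellable
      mp_invertible_imp_regular_gram_power_star[OF _ assms] by blast
next
  assume "star_cancellable a \<and> regular_elt ((a\<^sup>\<star> * a) ^ n * a\<^sup>\<star>)"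
  then obtain c where canc: "star_cancellable a"
    and c: "(a\<^sup>\<star> * a) ^ n * a\<^sup>\<star> * c * ((a\<^sup>\<star> * a) ^ n * a\<^sup>\<star>) = (a\<^sup>\<star> * a) ^ n * a\<^sup>\<star>"
    by (auto simp: regular_elt_def)
  have "a * (a\<^sup>\<star> * c * (a\<^sup>\<star> * a) ^ n * a\<^sup>\<star>) = a * a\<^sup>\<star>"
    using c by (intro cancel_gram_power[OF canc assms]) (simp add: mult.assoc)
  \<comment> \<open>Written in this form, the equation can be cancelled once more, now for \<open>a\<^sup>\<star>\<close> and with exponent 1.\<close>
  then have "((a\<^sup>\<star>)\<^sup>\<star> * a\<^sup>\<star>) ^ 1 * (c * ((a\<^sup>\<star> * a) ^ n * a\<^sup>\<star>)) = ((a\<^sup>\<star>)\<^sup>\<star> * a\<^sup>\<star>) ^ 1 * 1"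
    by (simp add: star_star mult.assoc)
  then have "a\<^sup>\<star> * (c * ((a\<^sup>\<star> * a) ^ n * a\<^sup>\<star>)) = a\<^sup>\<star> * 1"
    by (rule cancel_gram_power[rotated 2]) (simp_all add: canc star_cancellable_star)
  then have "(a\<^sup>\<star> * (c * ((a\<^sup>\<star> * a) ^ n * a\<^sup>\<star>)))\<^sup>\<star> = a"
    by (simp add: star_star)
  then have "a = a * (a\<^sup>\<star> * a) ^ n * (c\<^sup>\<star> * a)"
    by (simp add: star_mult star_star mult.assoc)
  then show "mp_invertible a"
    using mp_invertible_iff_right_multiple[OF assms] by blast
qed

lemma mp_invertible_iff_group_invertible_gram_power:
  fixes a :: "'a::involution_ring"
  assumes "n > 0"
  shows "mp_invertible a \<longleftrightarrow> star_cancellable a \<and> group_invertible ((a\<^sup>\<star> * a) ^ n)"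
proof
  assume "mp_invertible a"
  then show "star_cancellable a \<and> group_invertible ((a\<^sup>\<star> * a) ^ n)"
    using mp_invertible_imp_star_cancellable mp_invertible_gram_power(2)[OF _ assms] by blast
next
  assume *: "star_cancellable a \<and> group_invertible ((a\<^sup>\<star> * a) ^ n)"
  then obtain c where "(a\<^sup>\<star> * a) ^ n = (a\<^sup>\<star> * a) ^ n * ((a\<^sup>\<star> * a) ^ n * c)"
    unfolding group_invertible_def by (metis mult.assoc)
  then show "mp_invertible a"
    using * mp_invertible_of_cancellable_gram_power[OF _ assms] by blast
qed

lemma mp_invertible_iff_mp_invertible_gram_power:
  fixes a :: "'a::involution_ring"
  assumes "n > 0"
  shows "mp_invertible a \<longleftrightarrow> star_cancellable a \<and> mp_invertible ((a\<^sup>\<star> * a) ^ n)"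
proof
  assume "mp_invertible a"
  then show "star_cancellable a \<and> mp_invertible ((a\<^sup>\<star> * a) ^ n)"
    using mp_invertible_imp_star_cancellable mp_invertible_gram_power(1)[OF _ assms] by blast
next
  assume *: "star_cancellable a \<and> mp_invertible ((a\<^sup>\<star> * a) ^ n)"
  define u where "u = (a\<^sup>\<star> * a) ^ n"
  have "u * (u\<^sup>\<dagger> * u) = u"
    using * is_mp_inverse_mp_inverse[of u] by (simp add: u_def is_mp_inverse_def mult.assoc)
  then have "u = u * (u * u\<^sup>\<dagger>)"
    using * mp_inverse_commutes_self_adjoint[of u] by (simp add: u_def)
  then show "mp_invertible a"
    using * mp_invertible_of_cancellable_gram_power[OF _ assms] unfolding u_def by blast
qed

lemma mp_invertible_iff_regular_gram_powers:
  fixes a :: "'a::involution_ring"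
  assumes "m > 0" and "n > 0"
  shows "mp_invertible a \<longleftrightarrow>
    star_cancellable a \<and> regular_elt ((a * a\<^sup>\<star>) ^ m) \<and> regular_elt ((a\<^sup>\<star> * a) ^ n)"
proof
  assume a: "mp_invertible a"
  have reg: "regular_elt c" if "group_invertible c" for c :: 'a
    using that by (auto simp: regular_elt_def group_invertible_def)
  show "star_cancellable a \<and> regular_elt ((a * a\<^sup>\<star>) ^ m) \<and> regular_elt ((a\<^sup>\<star> * a) ^ n)"
    using a mp_invertible_imp_star_cancellable reg mp_invertible_gram_power(2)[OF a assms(2)]
      mp_invertible_gram_power(2)[of "a\<^sup>\<star>", OF _ assms(1)]
    by (simp add: mp_invertible_star star_star)
next
  assume *: "star_cancellable a \<and> regular_elt ((a * a\<^sup>\<star>) ^ m) \<and> regular_elt ((a\<^sup>\<star> * a) ^ n)"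
  obtain x where x: "a = x * (a\<^sup>\<star> * a) ^ n"
    using * factorization_of_regular_gram_power[OF _ assms(2)] by blast
  obtain y where "a\<^sup>\<star> = y * (a * a\<^sup>\<star>) ^ m"
    using * factorization_of_regular_gram_power[of "a\<^sup>\<star>", OF _ assms(1)]
    by (auto simp: star_cancellable_star star_star)
  then have "a\<^sup>\<star>\<^sup>\<star> = (y * (a * a\<^sup>\<star>) ^ m)\<^sup>\<star>" by simp
  then have "a = (a * a\<^sup>\<star>) ^ m * y\<^sup>\<star>" by (simp add: star_mult star_star)
  with x show "mp_invertible a"
    using is_mp_inverse_of_power_factorizations[OF assms(2,1)] mp_invertible_def by blast
qed

lemma mp_invertible_iff_left_multiple:
  fixes a :: "'a::involution_ring"
  assumes "n > 0"
  shows "mp_invertible a \<longleftrightarrow> (\<exists>y. a = y * (a * a\<^sup>\<star>) ^ n * a)"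
proof
  assume "mp_invertible a"
  then obtain x where "a\<^sup>\<star> = a\<^sup>\<star> * (a * a\<^sup>\<star>) ^ n * x"
    using mp_invertible_iff_right_multiple[of n "a\<^sup>\<star>", OF assms]
    by (auto simp: mp_invertible_star star_star)
  then have "a\<^sup>\<star>\<^sup>\<star> = (a\<^sup>\<star> * (a * a\<^sup>\<star>) ^ n * x)\<^sup>\<star>" by simp
  then show "\<exists>y. a = y * (a * a\<^sup>\<star>) ^ n * a"
    by (auto simp: star_mult star_star mult.assoc)
next
  assume "\<exists>y. a = y * (a * a\<^sup>\<star>) ^ n * a"
  then show "mp_invertible a"
    using is_mp_inverse_of_left_power_factorization[OF assms] mp_invertible_def by blast
qed

lemma mp_invertible_iff_two_sided_multiple:
  fixes a :: "'a::involution_ring"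
  assumes "m > 0" and "n > 0"
  shows "mp_invertible a \<longleftrightarrow> (\<exists>x. a = x * (a\<^sup>\<star> * a) ^ m) \<and> (\<exists>y. a = (a * a\<^sup>\<star>) ^ n * y)"
proof
  assume a: "mp_invertible a"
  obtain x where "a = a * (a\<^sup>\<star> * a) ^ n * x"
    using mp_invertible_factorizations(1)[OF a assms(2)] by blast
  then have "a = (a * a\<^sup>\<star>) ^ n * (a * x)"
    by (simp add: mult_power_shift mult.assoc)
  then show "(\<exists>x. a = x * (a\<^sup>\<star> * a) ^ m) \<and> (\<exists>y. a = (a * a\<^sup>\<star>) ^ n * y)"
    using mp_invertible_factorizations(2)[OF a assms(1)] by blast
next
  assume "(\<exists>x. a = x * (a\<^sup>\<star> * a) ^ m) \<and> (\<exists>y. a = (a * a\<^sup>\<star>) ^ n * y)"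
  then show "mp_invertible a"
    using is_mp_inverse_of_power_factorizations[OF assms] mp_invertible_def by blast
qed

text \<open>
  This is the adjoint of the corresponding condition on \<open>a\<^sup>\<star>\<close>; the Moore-Penrose inverse of the
  self-adjoint power survives taking adjoints because it is itself self-adjoint.
\<close>
lemma mp_invertible_iff_cogram_projection:
  fixes a :: "'a::involution_ring"
  assumes "n > 0"
  shows "mp_invertible a \<longleftrightarrow>
    mp_invertible ((a * a\<^sup>\<star>) ^ n) \<and> (a * a\<^sup>\<star>) ^ n * ((a * a\<^sup>\<star>) ^ n)\<^sup>\<dagger> * a = a"
proof -
  define h where "h = (a * a\<^sup>\<star>) ^ n"
  have h_star: "h\<^sup>\<star> = h" by (simp add: h_def)
  have "a\<^sup>\<star> * h\<^sup>\<dagger> * h = a\<^sup>\<star> \<longleftrightarrow> h * h\<^sup>\<dagger> * a = a" if "mp_invertible h"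
  proof -
    have "(h * h\<^sup>\<dagger> * a)\<^sup>\<star> = a\<^sup>\<star> * h\<^sup>\<dagger> * h"
      by (simp add: star_mult mult.assoc h_star mp_inverse_self_adjoint[OF that h_star])
    then show ?thesis by (metis star_eq_iff)
  qed
  then show ?thesis
    using mp_invertible_iff_gram_projection[of n "a\<^sup>\<star>", OF assms]
    by (auto simp: mp_invertible_star star_star h_def)
qed

theorem theorem3p1:
  fixes a :: "'a::involution_ring" and m n :: nat
  assumes "m > 0" and "n > 0"
  shows
    "(mp_invertible a \<longleftrightarrow>
        a \<in> left_multiples ((a\<^sup>\<star> * a) ^ m) \<inter> right_multiples ((a * a\<^sup>\<star>) ^ n)) \<and>
     (mp_invertible a \<longleftrightarrow> a \<in> right_multiples (a * (a\<^sup>\<star> * a) ^ n)) \<and>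
     (mp_invertible a \<longleftrightarrow> a \<in> left_multiples ((a * a\<^sup>\<star>) ^ n * a)) \<and>
     (mp_invertible a \<longleftrightarrow>
        mp_invertible ((a * a\<^sup>\<star>) ^ n) \<and> (a * a\<^sup>\<star>) ^ n * ((a * a\<^sup>\<star>) ^ n)\<^sup>\<dagger> * a = a) \<and>
     (mp_invertible a \<longleftrightarrow>
        mp_invertible ((a\<^sup>\<star> * a) ^ n) \<and> a * ((a\<^sup>\<star> * a) ^ n)\<^sup>\<dagger> * (a\<^sup>\<star> * a) ^ n = a) \<and>
     (mp_invertible a \<longleftrightarrow>
        star_cancellable a \<and> regular_elt ((a * a\<^sup>\<star>) ^ m) \<and> regular_elt ((a\<^sup>\<star> * a) ^ n)) \<and>
     (mp_invertible a \<longleftrightarrow> star_cancellable a \<and> regular_elt ((a\<^sup>\<star> * a) ^ n * a\<^sup>\<star>)) \<and>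
     (mp_invertible a \<longleftrightarrow> star_cancellable a \<and> regular_elt (a\<^sup>\<star> * (a * a\<^sup>\<star>) ^ n)) \<and>
     (mp_invertible a \<longleftrightarrow> star_cancellable a \<and> group_invertible ((a * a\<^sup>\<star>) ^ n)) \<and>
     (mp_invertible a \<longleftrightarrow> star_cancellable a \<and> group_invertible ((a\<^sup>\<star> * a) ^ n)) \<and>
     (mp_invertible a \<longleftrightarrow> star_cancellable a \<and> mp_invertible ((a * a\<^sup>\<star>) ^ n)) \<and>
     (mp_invertible a \<longleftrightarrow> star_cancellable a \<and> mp_invertible ((a\<^sup>\<star> * a) ^ n)) \<and>
     (mp_invertible a \<longrightarrow>
        (\<forall>x\<^sub>1 y\<^sub>1. a = x\<^sub>1 * (a\<^sup>\<star> * a) ^ m \<and> a = (a * a\<^sup>\<star>) ^ n * y\<^sub>1 \<longrightarrow>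
           a\<^sup>\<dagger> = y\<^sub>1\<^sup>\<star> * (a * a\<^sup>\<star>) ^ (m + n - 2) * a * x\<^sub>1\<^sup>\<star>) \<and>
        (\<forall>x\<^sub>2. a = a * (a\<^sup>\<star> * a) ^ n * x\<^sub>2 \<longrightarrow>
           a\<^sup>\<dagger> = x\<^sub>2\<^sup>\<star> * (a\<^sup>\<star> * a) ^ (2 * n - 1) * x\<^sub>2 * a\<^sup>\<star>) \<and>
        (\<forall>y\<^sub>2. a = y\<^sub>2 * (a * a\<^sup>\<star>) ^ n * a \<longrightarrow>
           a\<^sup>\<dagger> = a\<^sup>\<star> * y\<^sub>2 * (a * a\<^sup>\<star>) ^ (2 * n - 1) * y\<^sub>2\<^sup>\<star>))"
proof -
  note dual = mp_invertible_star star_cancellable_star star_star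
  have shift: "a\<^sup>\<star> * (a * a\<^sup>\<star>) ^ n = (a\<^sup>\<star> * a) ^ n * a\<^sup>\<star>"
    by (rule mult_power_shift)
  show ?thesis
  proof (intro conjI)
    show "mp_invertible a \<longleftrightarrow>
        a \<in> left_multiples ((a\<^sup>\<star> * a) ^ m) \<inter> right_multiples ((a * a\<^sup>\<star>) ^ n)"
      using mp_invertible_iff_two_sided_multiple[OF assms, of a]
      by (simp add: left_multiples_def right_multiples_def)
    show "mp_invertible a \<longleftrightarrow> a \<in> right_multiples (a * (a\<^sup>\<star> * a) ^ n)"
      using mp_invertible_iff_right_multiple[OF assms(2), of a]
      by (simp add: right_multiples_def)
    show "mp_invertible a \<longleftrightarrow> a \<in> left_multiples ((a * a\<^sup>\<star>) ^ n * a)"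
      using mp_invertible_iff_left_multiple[OF assms(2), of a]
      by (simp add: left_multiples_def mult.assoc)
    show "mp_invertible a \<longleftrightarrow>
        mp_invertible ((a * a\<^sup>\<star>) ^ n) \<and> (a * a\<^sup>\<star>) ^ n * ((a * a\<^sup>\<star>) ^ n)\<^sup>\<dagger> * a = a"
      by (rule mp_invertible_iff_cogram_projection[OF assms(2)])
    show "mp_invertible a \<longleftrightarrow>
        mp_invertible ((a\<^sup>\<star> * a) ^ n) \<and> a * ((a\<^sup>\<star> * a) ^ n)\<^sup>\<dagger> * (a\<^sup>\<star> * a) ^ n = a"
      by (rule mp_invertible_iff_gram_projection[OF assms(2)])
    show "mp_invertible a \<longleftrightarrow>
        star_cancellable a \<and> regular_elt ((a * a\<^sup>\<star>) ^ m) \<and> regular_elt ((a\<^sup>\<star> * a) ^ n)"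
      by (rule mp_invertible_iff_regular_gram_powers[OF assms])
    show "mp_invertible a \<longleftrightarrow> star_cancellable a \<and> regular_elt ((a\<^sup>\<star> * a) ^ n * a\<^sup>\<star>)"
      by (rule mp_invertible_iff_regular_gram_power_star[OF assms(2)])
    then show "mp_invertible a \<longleftrightarrow> star_cancellable a \<and> regular_elt (a\<^sup>\<star> * (a * a\<^sup>\<star>) ^ n)"
      by (simp only: shift)
    show "mp_invertible a \<longleftrightarrow> star_cancellable a \<and> group_invertible ((a * a\<^sup>\<star>) ^ n)"
      using mp_invertible_iff_group_invertible_gram_power[OF assms(2), of "a\<^sup>\<star>"]
      by (simp only: dual)
    show "mp_invertible a \<longleftrightarrow> star_cancellable a \<and> group_invertible ((a\<^sup>\<star> * a) ^ n)"
      by (rule mp_invertible_iff_group_invertible_gram_power[OF assms(2)])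
    show "mp_invertible a \<longleftrightarrow> star_cancellable a \<and> mp_invertible ((a * a\<^sup>\<star>) ^ n)"
      using mp_invertible_iff_mp_invertible_gram_power[OF assms(2), of "a\<^sup>\<star>"]
      by (simp only: dual)
    show "mp_invertible a \<longleftrightarrow> star_cancellable a \<and> mp_invertible ((a\<^sup>\<star> * a) ^ n)"
      by (rule mp_invertible_iff_mp_invertible_gram_power[OF assms(2)])
  next
    show "mp_invertible a \<longrightarrow>
        (\<forall>x\<^sub>1 y\<^sub>1. a = x\<^sub>1 * (a\<^sup>\<star> * a) ^ m \<and> a = (a * a\<^sup>\<star>) ^ n * y\<^sub>1 \<longrightarrow>
           a\<^sup>\<dagger> = y\<^sub>1\<^sup>\<star> * (a * a\<^sup>\<star>) ^ (m + n - 2) * a * x\<^sub>1\<^sup>\<star>) \<and>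
        (\<forall>x\<^sub>2. a = a * (a\<^sup>\<star> * a) ^ n * x\<^sub>2 \<longrightarrow>
           a\<^sup>\<dagger> = x\<^sub>2\<^sup>\<star> * (a\<^sup>\<star> * a) ^ (2 * n - 1) * x\<^sub>2 * a\<^sup>\<star>) \<and>
        (\<forall>y\<^sub>2. a = y\<^sub>2 * (a * a\<^sup>\<star>) ^ n * a \<longrightarrow>
           a\<^sup>\<dagger> = a\<^sup>\<star> * y\<^sub>2 * (a * a\<^sup>\<star>) ^ (2 * n - 1) * y\<^sub>2\<^sup>\<star>)"
      using is_mp_inverse_of_power_factorizations[OF assms, of a]
        is_mp_inverse_of_right_power_factorization[OF assms(2), of a]
        is_mp_inverse_of_left_power_factorization[OF assms(2), of a]
        mp_inverse_eqI[of a]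
      by blast
  qed
qed

end
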